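(* Let $n\ge1$ and let $\pi$ be a permutation of $\{0,1,\dots,n-1\}$ consisting of a single cycle. Then the words $u=0\,1\,\cdots\,(n-1)$ and $v=\pi(0)\,\pi(1)\,\cdots\,\pi(n-1)$ over the alphabet $\{0,1,\dots,n-1\}$ are cyclically equalizable.
   Context: Two words $x=x_0\cdots x_{N-1}$, $y$ of length $N$ are cyclically equivalent if $y=x_rx_{r+1}\cdots x_{N-1}x_0\cdots x_{r-1}$ for some integer $r$. Given words $w_1,w_2\in\Sigma^n$ with $w_i=a_{i,0}\cdots a_{i,n-1}$, a simultaneous insertion transforms each $w_i$ into $x_0a_{i,0}x_1a_{i,1}\cdots x_{n-1}a_{i,n-1}x_n$, where the words $x_0,\dots,x_n\in\Sigma^*$ are the same for both $i$. Two words of equal length are cyclically equalizable if some simultaneous insertion transforms them into cyclically equivalent words. *)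

theory Defs
  imports Main "HOL-Combinatorics.Orbits"
begin

(* rotate reduces r modulo the length, which is the reading of the indices
   of x_r x_(r+1) ... x_(N-1) x_0 ... x_(r-1) for arbitrary r. *)
definition cyclically_equivalent :: "'a list \<Rightarrow> 'a list \<Rightarrow> bool" where
  "cyclically_equivalent x y \<longleftrightarrow> (\<exists>r. y = rotate r x)"

(* x_0 a_0 x_1 a_1 ... x_(n-1) a_(n-1) x_n, where w = a_0 ... a_(n-1);
   only the values of x at 0, ..., n matter. *)
definition insertion :: "(nat \<Rightarrow> 'a list) \<Rightarrow> 'a list \<Rightarrow> 'a list" where
  "insertion x w = concat (map (\<lambda>i. x i @ [w ! i]) [0..<length w]) @ x (length w)"

(* The first argument is the alphabet, from which the inserted words are drawn as well. *)
definition cyclically_equalizable :: "'a set \<Rightarrow> 'a list \<Rightarrow> 'a list \<Rightarrow> bool" where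
  "cyclically_equalizable \<Sigma> w1 w2 \<longleftrightarrow>
     w1 \<in> lists \<Sigma> \<and> w2 \<in> lists \<Sigma> \<and> length w1 = length w2 \<and>
     (\<exists>x. (\<forall>i\<le>length w1. x i \<in> lists \<Sigma>) \<and>
          cyclically_equivalent (insertion x w1) (insertion x w2))"

end

theory Submission
  imports Defs
begin

text \<open>
  Let \<open>m = n + 1\<close> and \<open>N = m\<^sup>2 - 1\<close>. Multiplication by \<open>m\<close> modulo \<open>N\<close> swaps the two base-\<open>m\<close> digits
  of \<open>a + b m\<close>. Writing \<open>c a\<close> for the \<open>a\<close>-th iterate of \<open>\<pi>\<close> at \<open>0\<close>, put the letter of index \<open>b = c a\<close>
  at position \<open>a + b m\<close>. These positions increase with \<open>b\<close>, whereas the walk on \<open>\<int>/N\<int>\<close> with step \<open>m\<close>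
  meets them in increasing order of \<open>a\<close>, that is, in the order of the cycle. Hence there is a word whose letter
  is constant along this walk except that \<open>\<pi>\<close> is applied to it after each marked position, and
  rotating that word by \<open>m\<close> amounts to applying \<open>\<pi>\<close> exactly at the marked positions.
\<close>

text \<open>The letters of \<open>w\<close> sit at the positions \<open>P i\<close>, and
  \<open>x i\<close> fills the gap just before \<open>P i\<close>. The value
  \<open>P (length w)\<close> marks no letter: it is the total length, so the last gap runs to the
  end.\<close>

lemma insertion_map_upt:
  assumes less: "\<And>i. i < length w \<Longrightarrow> P i < P (Suc i)"
    and marked: "\<And>i. i < length w \<Longrightarrow> F (P i) = w ! i"
    and x: "\<And>i. i \<le> length w \<Longrightarrow> x i = map F [(case i of 0 \<Rightarrow> 0 | Suc k \<Rightarrow> Suc (P k))..<P i]"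
  shows "insertion x w = map F [0..<P (length w)]"
proof -
  let ?s = "\<lambda>i. case i of 0 \<Rightarrow> 0 | Suc k \<Rightarrow> Suc (P k)"
  have s_le: "?s i \<le> P i" if "i \<le> length w" for i
    using less that by (cases i) (auto simp: Suc_le_eq)
  have join: "map F [0..<?s i] @ x i = map F [0..<P i]" if "i \<le> length w" for i
    using upt_add_eq_append[of 0 "?s i" "P i - ?s i"] s_le[OF that] x[OF that]
    by (simp flip: map_append)
  have "concat (map (\<lambda>i. x i @ [w ! i]) [0..<k]) = map F [0..<?s k]" if "k \<le> length w" for k
    using that
  proof (induction k)
    case 0
    then show ?case by simp
  next
    case (Suc k)
    then show ?case using join[of k] marked[of k] by simp
  qed
  from this[of "length w"] show ?thesis
    using join[of "length w"] by (simp add: insertion_def)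
qed

text \<open>The iterates of \<open>s\<close> before its first return, at time
  \<open>funpow_dist1 f s s\<close>, are distinct and exhaust the orbit, which is \<open>S\<close>;
  hence that time is \<open>card S\<close>.\<close>

lemma cyclic_on_bij_betw_funpow:
  assumes "cyclic_on f S" "s \<in> S"
  shows "bij_betw (\<lambda>k. (f ^^ k) s) {..<card S} S" and "(f ^^ card S) s = s"
proof -
  let ?p = "funpow_dist1 f s s"
  have orb: "orbit f s = S" using assms by (rule orbit_cyclic_eq3)
  then have self: "s \<in> orbit f s" using assms(2) by simp
  have bij: "bij_betw (\<lambda>k. (f ^^ k) s) {0..<?p} S"
    unfolding bij_betw_def
    using inj_on_funpow_dist1[OF self] orbit_conv_funpow_dist1[OF self] orb by simp
  then have p: "card S = ?p" using bij_betw_same_card by fastforce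
  show "bij_betw (\<lambda>k. (f ^^ k) s) {..<card S} S"
    using bij unfolding p by (simp only: atLeast0LessThan)
  show "(f ^^ card S) s = s"
    unfolding p using self by (rule funpow_dist1_prop)
qed

theorem theorem4:
  fixes n :: nat and \<pi> :: "nat \<Rightarrow> nat"
  assumes "n \<ge> 1"
    and "\<pi> permutes {0..<n}"
    and "cyclic_on \<pi> {0..<n}"
  shows "cyclically_equalizable {0..<n} [0..<n] (map \<pi> [0..<n])"
proof -
  define m where "m = Suc n"
  define N where "N = n + n * m"
  define c where "c a = (\<pi> ^^ a) 0" for a
  have bij: "bij_betw c {..<n} {0..<n}" and c_n: "c n = 0"
    using cyclic_on_bij_betw_funpow[OF assms(3), of 0] assms(1) by (simp_all add: c_def[abs_def])
  have c_0: "c 0 = 0" and c_Suc: "c (Suc a) = \<pi> (c a)" for a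
    by (simp_all add: c_def)
  have c_less: "c a < n" for a
    using cyclic_on_funpow_in[OF assms(3), of 0 a] assms(1) by (simp add: c_def)
  \<comment> \<open>The inverse of \<open>c\<close>; the value \<open>n\<close> outside its range
    makes \<open>P n\<close> equal to \<open>N\<close>, the end of the word.\<close>
  define d where "d b = (if b < n then inv_into {..<n} c b else n)" for b
  have d: "d b < n" "c (d b) = b" if "b < n" for b
    using bij that inv_into_into[of b c "{..<n}"] f_inv_into_f[of b c "{..<n}"]
    by (auto simp: d_def bij_betw_def)
  have d_c: "d (c a) = a" if "a < n" for a
    using bij that c_less by (simp add: d_def bij_betw_def)
  have d_less: "d b < m" for b
    using d(1)[of b] by (cases "b < n") (auto simp: m_def d_def)
  define P where "P b = d b + b * m" for b
  have P_less: "P i < P j" if "i < j" for i j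
  proof -
    have "P i < Suc i * m" using d_less[of i] by (simp add: P_def)
    also have "\<dots> \<le> j * m" using that by (intro mult_le_mono1) simp
    finally show ?thesis by (simp add: P_def)
  qed
  have P_n: "P n = N" by (simp add: P_def N_def d_def)
  \<comment> \<open>On the residue class of \<open>a < n\<close>, the letter changes from
    \<open>c a\<close> to \<open>c (Suc a)\<close> at \<open>b = c a\<close>. \<open>F\<close> is
    the letter before position \<open>j\<close> acts and \<open>G\<close> the one after, so
    \<open><\<close> becomes \<open>\<le>\<close> and they differ at most at marked
    positions.\<close>
  define F where "F j = (let a = j mod m; b = j div m in
    if a < n \<and> c a < b then c (Suc a) else c a)" for j
  define G where "G j = (let a = j mod m; b = j div m in
    if a < n \<and> c a \<le> b then c (Suc a) else c a)" for j
  have digits: "(a + b * m) mod m = a" "(a + b * m) div m = b" if "a < m" for a b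
    using that by simp_all
  have F_P: "F (P i) = i" and G_P: "G (P i) = \<pi> i" if "i < n" for i
    using d[OF that] d_less[of i] digits by (simp_all add: F_def G_def P_def c_Suc)
  have F_eq_G: "F j = G j" if "\<And>i. i < n \<Longrightarrow> j \<noteq> P i" for j
  proof -
    have "\<not> (j mod m < n \<and> c (j mod m) = j div m)"
    proof
      assume a: "j mod m < n \<and> c (j mod m) = j div m"
      then have "P (c (j mod m)) = j" using d_c[of "j mod m"] by (metis P_def mod_div_mult_eq)
      with that[of "c (j mod m)"] show False using c_less by metis
    qed
    then show ?thesis by (auto simp: F_def G_def Let_def)
  qed
  define x where "x i = map F [(case i of 0 \<Rightarrow> 0 | Suc k \<Rightarrow> Suc (P k))..<P i]" for i
  have x_G: "x i = map G [(case i of 0 \<Rightarrow> 0 | Suc k \<Rightarrow> Suc (P k))..<P i]" for i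
    unfolding x_def
  proof (rule map_cong[OF refl], rule F_eq_G)
    fix j b
    assume j: "j \<in> set [(case i of 0 \<Rightarrow> 0 | Suc k \<Rightarrow> Suc (P k))..<P i]"
    show "j \<noteq> P b"
    proof (cases "b < i")
      case True
      then obtain k where k: "i = Suc k" "b \<le> k" by (cases i) auto
      then have "P b \<le> P k" using P_less[of b k] by (cases "b = k") auto
      then show ?thesis using j k by simp
    next
      case False
      then have "P i \<le> P b" using P_less[of i b] by (cases "b = i") auto
      then show ?thesis using j by simp
    qed
  qed
  have ins_F: "insertion x [0..<n] = map F [0..<N]"
    using insertion_map_upt[of "[0..<n]" P F x] by (simp add: P_less P_n F_P x_def)
  have ins_G: "insertion x (map \<pi> [0..<n]) = map G [0..<N]"
    using insertion_map_upt[of "map \<pi> [0..<n]" P G x] by (simp add: P_less P_n G_P x_G)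
  have shift: "G j = F ((m + j) mod N)" if "j < N" for j
  proof -
    define a b where "a = j mod m" and "b = j div m"
    have j: "j = a + b * m" by (simp add: a_def b_def)
    have a: "a < m" by (simp add: a_def m_def)
    have N: "Suc N = m * m" by (simp add: N_def m_def)
    have b: "b < m" using that N by (simp add: b_def less_mult_imp_div_less)
    \<comment> \<open>A step of the walk stays in the residue class of \<open>a\<close>, or hits
      \<open>N\<close> exactly and wraps to 0, or leaves the top row \<open>b = n\<close> for
      \<open>Suc a\<close>. In that row \<open>a = n\<close> would give
      \<open>j = N\<close>.\<close>
    consider "b < n" "m + j < N" | "b < n" "m + j = N" | "b = n" "a < n"
    proof -
      have "b < n \<or> b = n" using b by (auto simp: m_def)
      moreover have "m + j \<le> N" if "b < n"
      proof -
        have "Suc (Suc b) * m \<le> m * m" using that unfolding m_def by (intro mult_le_mono1) simp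
        then show ?thesis using a j N by simp
      qed
      moreover have "a < n" if "b = n"
        using that \<open>j < N\<close> j by (simp add: N_def)
      ultimately show thesis using that by fastforce
    qed
    then show ?thesis
    proof cases
      case 1
      have mj: "m + j = a + Suc b * m" using j by simp
      have "F (m + j) = G j"
        unfolding mj unfolding j F_def G_def digits[OF a] by (simp add: less_Suc_eq_le)
      then show ?thesis using 1 by simp
    next
      case 2
      \<comment> \<open>Hitting \<open>N\<close> forces \<open>a = n\<close>, the last class; there
        the letter is \<open>c n = 0\<close>, so the walk closes up.\<close>
      have "Suc a + Suc b * m = m * m" using 2 j N by simp
      then have "m dvd Suc a"
        by (metis dvd_add_left_iff dvd_triv_right)
      then have "a = n" using a by (auto simp: m_def dest: dvd_imp_le)
      then have "G j = 0" using j digits[OF a] by (simp add: G_def c_n)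
      moreover have "F 0 = 0" by (simp add: F_def c_0)
      ultimately show ?thesis using 2 by simp
    next
      case 3
      \<comment> \<open>Here \<open>m * m = Suc N\<close> turns the carry out of the top digit into
        an increase of the low digit.\<close>
      have "m + j = Suc a + N" using 3 j by (simp add: m_def N_def)
      moreover have "Suc a < N" using 3 assms(1) by (simp add: N_def m_def)
      ultimately have "(m + j) mod N = Suc a" by (metis mod_add_self2 mod_less)
      moreover have "F (Suc a) = c (Suc a)"
        using 3 by (simp add: F_def m_def)
      moreover have "G j = c (Suc a)"
        using 3 j digits[OF a] c_less[of a] by (simp add: G_def)
      ultimately show ?thesis by simp
    qed
  qed
  have "map G [0..<N] = rotate m (map F [0..<N])"
    by (rule nth_equalityI) (auto simp: nth_rotate shift)
  moreover have "F j < n" for j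
    using c_less by (simp add: F_def Let_def)
  then have "x i \<in> lists {0..<n}" for i
    by (auto simp: x_def)
  moreover have "\<pi> i < n" if "i < n" for i
    using permutes_in_image[OF assms(2), of i] that by simp
  ultimately show ?thesis
    unfolding cyclically_equalizable_def cyclically_equivalent_def ins_F ins_G
    by (auto intro!: exI[of _ x] simp: ins_F ins_G)
qed

end
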